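(* Let $\mathcal{B}=(e_n)_{n=1}^\infty$ be a basis of a Banach space $\mathbb{X}$. (1) $\mathcal{B}$ is unconditional if and only if $\mathcal{B}$ is $\omega$-greedy for some weight $\omega$ on subsets of $\mathbb{N}$. (2) $\mathcal{B}$ is quasi-greedy if and only if $\mathcal{B}$ is $\omega$-almost greedy for some weight $\omega$ on subsets of $\mathbb{N}$.
   Context: $\mathbb{X}$ is a Banach space over $\mathbb{K}=\mathbb{R}$ or $\mathbb{C}$. A basis of $\mathbb{X}$ means a semi-normalized Schauder basis $(e_n)_{n=1}^\infty$, i.e. $0<\inf_n\|e_n\|\le\sup_n\|e_n\|<\infty$, with biorthogonal functionals $(e_n^* )_{n=1}^\infty\subset\mathbb{X}^*$. $\mathbb{N}^{<\infty}$ is the set of finite subsets of $\mathbb{N}$. $P_A(x)=\sum_{n\in A}e_n^*(x)e_n$. A weight on sets is a function $\omega:\mathcal{P}(\mathbb{N})\to[0,\infty]$, whose value at $A$ is written $w(A)$, such that $w(\emptyset)=0$ and $w(A)\in(0,\infty]$ for every nonempty $A\subset\mathbb{N}$. Greedy sets: for $x\in\mathbb{X}$, $m\in\mathbb{N}$, a greedy set of order $m$ of $x$ is a set $\Lambda_m(x)\subset\mathbb{N}$ with $|\Lambda_m(x)|=m$ and $\min_{n\in\Lambda_m(x)}|e_n^*(x)|\ge\max_{n\notin\Lambda_m(x)}|e_n^*(x)|$; the corresponding greedy sum is $G_m(x)=\sum_{n\in\Lambda_m(x)}e_n^*(x)e_n$. $\mathcal{B}$ is unconditional if there is $C\ge1$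 with $\|P_A(x)\|\le C\|x\|$ for all $x\in\mathbb{X}$ and all $A\subset\mathbb{N}$. $\mathcal{B}$ is quasi-greedy if there is $C\ge1$ with $\|x-G_m(x)\|\le C\|x\|$ for all $x\in\mathbb{X}$, $m\in\mathbb{N}$ and all greedy sets $\Lambda_m(x)$. For $B\subset\mathbb{N}$ let $$\sigma^\omega_B(x)=\inf\Big\{\Big\|x-\sum_{n\in A}a_ne_n\Big\|: A\in\mathbb{N}^{<\infty},\ w(A\setminus B)\le w(B\setminus A),\ a_n\in\mathbb{K}\Big\},$$ $$\widetilde\sigma^\omega_B(x)=\inf\{\|x-P_A(x)\|: A\in\mathbb{N}^{<\infty},\ w(A\setminus B)\le w(B\setminus A)\}.$$ $\mathcal{B}$ is $\omega$-greedy (respectively $\omega$-almost greedy) if there is $C\ge1$ such that for all $x\in\mathbb{X}$, $m\in\mathbb{N}$ and all greedy sets $\Lambda_m(x)$, $\|x-G_m(x)\|\le C\sigma^\omega_{\Lambda_m(x)}(x)$ (respectively $\|x-G_m(x)\|\le C\widetilde\sigma^\omega_{\Lambda_m(x)}(x)$). *)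

theory Defs
  imports "HOL-Analysis.Analysis"
begin

(* A Banach space over K, where K is the reals or the complex numbers. Both are instances of
   {real_normed_field, euclidean_space}; conversely, by Frobenius' theorem and multiplicativity
   of the norm, every type of this sort is isometrically isomorphic to one of them. The type
   class banach supplies the addition and the complete norm; smul is the scalar multiplication
   by K. (Compatibility of smul with the built-in real scaling is automatic: for fixed x the
   map r |-> smul (of_real r) x is additive and continuous.) *)
locale banach_space_over = vector_space smul
  for smul :: "'k::{real_normed_field, euclidean_space} \<Rightarrow> 'a::banach \<Rightarrow> 'a" +
  assumes norm_smul: "norm (smul c x) = norm c * norm x"

lemma banach_space_over_real:
  "banach_space_over (scaleR :: real \<Rightarrow> 'a::banach \<Rightarrow> 'a)"
  by unfold_locales (auto simp: algebra_simps)

lemma banach_space_over_complex: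
  "banach_space_over ((*) :: complex \<Rightarrow> complex \<Rightarrow> complex)"
  by unfold_locales (auto simp: algebra_simps norm_mult)

(* Indices run over nat, i.e. from 0. *)
definition schauder_basis ::
    "('k::{real_normed_field, euclidean_space} \<Rightarrow> 'a::banach \<Rightarrow> 'a) \<Rightarrow> (nat \<Rightarrow> 'a) \<Rightarrow> bool" where
  "schauder_basis smul e \<longleftrightarrow> (\<forall>x. \<exists>!a. (\<lambda>n. smul (a n) (e n)) sums x)"

definition seminormalized :: "(nat \<Rightarrow> 'a::real_normed_vector) \<Rightarrow> bool" where
  "seminormalized e \<longleftrightarrow>
     0 < (INF n. norm (e n)) \<and> bdd_above (range (\<lambda>n. norm (e n)))"

definition basis ::
    "('k::{real_normed_field, euclidean_space} \<Rightarrow> 'a::banach \<Rightarrow> 'a) \<Rightarrow> (nat \<Rightarrow> 'a) \<Rightarrow> bool" where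
  "basis smul e \<longleftrightarrow> schauder_basis smul e \<and> seminormalized e"

(* The biorthogonal functionals: coeff smul e n x is e_n^*(x). They are continuous by Banach's
   theorem on coordinate functionals, so continuity is not part of schauder_basis. *)
definition coeff ::
    "('k::{real_normed_field, euclidean_space} \<Rightarrow> 'a::banach \<Rightarrow> 'a) \<Rightarrow> (nat \<Rightarrow> 'a) \<Rightarrow>
     nat \<Rightarrow> 'a \<Rightarrow> 'k" where
  "coeff smul e n x = (THE a. (\<lambda>k. smul (a k) (e k)) sums x) n"

definition proj_term ::
    "('k::{real_normed_field, euclidean_space} \<Rightarrow> 'a::banach \<Rightarrow> 'a) \<Rightarrow> (nat \<Rightarrow> 'a) \<Rightarrow>
     nat set \<Rightarrow> 'a \<Rightarrow> nat \<Rightarrow> 'a" where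
  "proj_term smul e A x n = (if n \<in> A then smul (coeff smul e n x) (e n) else 0)"

(* P_A(x). For infinite A the series is taken in the order of the basis and need not converge,
   see unconditional below. *)
definition proj ::
    "('k::{real_normed_field, euclidean_space} \<Rightarrow> 'a::banach \<Rightarrow> 'a) \<Rightarrow> (nat \<Rightarrow> 'a) \<Rightarrow>
     nat set \<Rightarrow> 'a \<Rightarrow> 'a" where
  "proj smul e A x = (\<Sum>n. proj_term smul e A x n)"

lemma proj_finite:
  assumes "finite A"
  shows "proj smul e A x = (\<Sum>n\<in>A. smul (coeff smul e n x) (e n))"
  unfolding proj_def using assms
  by (subst suminf_finite[of A]) (auto simp: proj_term_def)

(* The bound on P_A(x) tacitly asserts that P_A(x) exists; since suminf is unspecified on
   divergent series, convergence is stated explicitly. *)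
definition unconditional ::
    "('k::{real_normed_field, euclidean_space} \<Rightarrow> 'a::banach \<Rightarrow> 'a) \<Rightarrow> (nat \<Rightarrow> 'a) \<Rightarrow> bool" where
  "unconditional smul e \<longleftrightarrow>
     (\<exists>C\<ge>1. \<forall>x A. summable (proj_term smul e A x) \<and> norm (proj smul e A x) \<le> C * norm x)"

(* L is a greedy set of order m of x. *)
definition greedy_set ::
    "('k::{real_normed_field, euclidean_space} \<Rightarrow> 'a::banach \<Rightarrow> 'a) \<Rightarrow> (nat \<Rightarrow> 'a) \<Rightarrow>
     'a \<Rightarrow> nat \<Rightarrow> nat set \<Rightarrow> bool" where
  "greedy_set smul e x m L \<longleftrightarrow>
     finite L \<and> card L = m \<and>
     (\<forall>n\<in>L. \<forall>k. k \<notin> L \<longrightarrow> norm (coeff smul e k x) \<le> norm (coeff smul e n x))"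

definition greedy_sum ::
    "('k::{real_normed_field, euclidean_space} \<Rightarrow> 'a::banach \<Rightarrow> 'a) \<Rightarrow> (nat \<Rightarrow> 'a) \<Rightarrow>
     nat set \<Rightarrow> 'a \<Rightarrow> 'a" where
  "greedy_sum smul e L x = (\<Sum>n\<in>L. smul (coeff smul e n x) (e n))"

definition quasi_greedy ::
    "('k::{real_normed_field, euclidean_space} \<Rightarrow> 'a::banach \<Rightarrow> 'a) \<Rightarrow> (nat \<Rightarrow> 'a) \<Rightarrow> bool" where
  "quasi_greedy smul e \<longleftrightarrow>
     (\<exists>C\<ge>1. \<forall>x. \<forall>m\<ge>1. \<forall>L. greedy_set smul e x m L \<longrightarrow>
        norm (x - greedy_sum smul e L x) \<le> C * norm x)"

definition weight :: "(nat set \<Rightarrow> ennreal) \<Rightarrow> bool" where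
  "weight w \<longleftrightarrow> w {} = 0 \<and> (\<forall>A. A \<noteq> {} \<longrightarrow> 0 < w A)"

definition sigma ::
    "('k::{real_normed_field, euclidean_space} \<Rightarrow> 'a::banach \<Rightarrow> 'a) \<Rightarrow> (nat \<Rightarrow> 'a) \<Rightarrow>
     (nat set \<Rightarrow> ennreal) \<Rightarrow> nat set \<Rightarrow> 'a \<Rightarrow> real" where
  "sigma smul e w B x =
     Inf {norm (x - (\<Sum>n\<in>A. smul (a n) (e n))) | A a. finite A \<and> w (A - B) \<le> w (B - A)}"

definition sigma_tilde ::
    "('k::{real_normed_field, euclidean_space} \<Rightarrow> 'a::banach \<Rightarrow> 'a) \<Rightarrow> (nat \<Rightarrow> 'a) \<Rightarrow>
     (nat set \<Rightarrow> ennreal) \<Rightarrow> nat set \<Rightarrow> 'a \<Rightarrow> real" where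
  "sigma_tilde smul e w B x =
     Inf {norm (x - proj smul e A x) | A. finite A \<and> w (A - B) \<le> w (B - A)}"

definition weight_greedy ::
    "('k::{real_normed_field, euclidean_space} \<Rightarrow> 'a::banach \<Rightarrow> 'a) \<Rightarrow> (nat \<Rightarrow> 'a) \<Rightarrow>
     (nat set \<Rightarrow> ennreal) \<Rightarrow> bool" where
  "weight_greedy smul e w \<longleftrightarrow>
     (\<exists>C\<ge>1. \<forall>x. \<forall>m\<ge>1. \<forall>L. greedy_set smul e x m L \<longrightarrow>
        norm (x - greedy_sum smul e L x) \<le> C * sigma smul e w L x)"

definition weight_almost_greedy ::
    "('k::{real_normed_field, euclidean_space} \<Rightarrow> 'a::banach \<Rightarrow> 'a) \<Rightarrow> (nat \<Rightarrow> 'a) \<Rightarrow>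
     (nat set \<Rightarrow> ennreal) \<Rightarrow> bool" where
  "weight_almost_greedy smul e w \<longleftrightarrow>
     (\<exists>C\<ge>1. \<forall>x. \<forall>m\<ge>1. \<forall>L. greedy_set smul e x m L \<longrightarrow>
        norm (x - greedy_sum smul e L x) \<le> C * sigma_tilde smul e w L x)"

end

theory Submission
  imports Defs
begin

text \<open>
  Both forward directions use the weight \<open>w(A) = \<parallel>1\<^sub>A\<parallel>\<close>, where \<open>1\<^sub>A\<close> is the sum of the \<open>e\<^sub>n\<close> with
  \<open>n \<in> A\<close>. For a quasi-greedy basis, \<open>|b\<^sub>n| \<le> s \<le> |c\<^sub>n|\<close> on a finite set \<open>F\<close> implies that the
  combination with coefficients \<open>b\<close> is bounded, up to a constant, by the one with coefficients \<open>c\<close>: a layer-cake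
  argument flattens \<open>c\<close> to constant modulus (superlevel sets of \<open>s/|c\<^sub>n|\<close> are complements of greedy
  sets), and a second one uses that every subset is greedy for a vector of constant modulus. So
  comparing weights compares the parts of \<open>x\<close> on \<open>A \<setminus> \<Lambda>\<close> and \<open>\<Lambda> \<setminus> A\<close>.

  Conversely, if the basis is \<open>\<omega>\<close>-greedy, adding \<open>\<alpha> 1\<^sub>B\<close> with large \<open>\<alpha>\<close> to \<open>x\<close> turns \<open>B\<close> into a greedy
  set, and \<open>\<alpha> 1\<^sub>B\<close> is itself an admissible approximant, whatever \<open>\<omega>\<close> is. In the almost greedy case
  the approximant \<open>0\<close> is enough.
\<close>

lemma le_mult_cInf:
  fixes a K :: real
  assumes "S \<noteq> {}" "K > 0" "\<And>s. s \<in> S \<Longrightarrow> a \<le> K * s"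
  shows "a \<le> K * Inf S"
proof -
  have "a / K \<le> Inf S"
    using assms by (intro cInf_greatest) (auto simp: divide_le_eq mult.commute)
  then show ?thesis
    using assms(2) by (simp add: divide_le_eq mult.commute)
qed

section \<open>Layer-cake and multiplier estimates for finite sums\<close>

context banach_space_over
begin

text \<open>Weights that are a superposition of indicators of their superlevel sets inherit the
  bound on the sums over those sets. The induction peels off the minimum \<open>m\<close>: the sum
  over all of \<open>A\<close> enters with factor \<open>m\<close>, and the superlevel sets of
  \<open>b - m\<close> are those of \<open>b\<close> at levels shifted by \<open>m\<close>.\<close>

lemma norm_sum_layer_cake:
  assumes "finite A"
    and "\<And>n. n \<in> A \<Longrightarrow> 0 \<le> b n \<and> b n \<le> \<beta>"
    and "\<And>t. t > 0 \<Longrightarrow> norm (\<Sum>n\<in>{n\<in>A. t \<le> b n}. z n) \<le> M"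
    and "0 \<le> \<beta>" "0 \<le> M"
  shows "norm (\<Sum>n\<in>A. smul (of_real (b n)) (z n)) \<le> \<beta> * M"
  using assms
proof (induction "card A" arbitrary: A b \<beta>)
  case 0
  then show ?case by simp
next
  case (Suc k)
  note fin = Suc.prems(1) and bnd = Suc.prems(2) and lev = Suc.prems(3)
  have ne: "A \<noteq> {}" using Suc.hyps(2) by auto
  define m where "m = Min (b ` A)"
  have "m \<in> b ` A" unfolding m_def using fin ne by (intro Min_in) auto
  then obtain j where j: "j \<in> A" "b j = m" by auto
  have m_le: "m \<le> b n" if "n \<in> A" for n
    unfolding m_def using fin that by (intro Min_le) auto
  have m0: "0 \<le> m" "m \<le> \<beta>" using bnd j by auto
  \<comment> \<open>Only positive levels are controlled, so \<open>A\<close> is known to be a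
    superlevel set with bounded sum only if \<open>m > 0\<close>; for \<open>m = 0\<close> the
    factor kills both sides.\<close>
  have whole: "m * norm (\<Sum>n\<in>A. z n) \<le> m * M"
  proof (cases "m = 0")
    case False
    then have "m > 0" using m0 by simp
    moreover have "{n\<in>A. m \<le> b n} = A" using m_le by auto
    ultimately show ?thesis using lev[of m] by simp
  qed simp
  have rest: "norm (\<Sum>n\<in>A - {j}. smul (of_real (b n - m)) (z n)) \<le> (\<beta> - m) * M"
  proof (rule Suc.hyps(1))
    show "k = card (A - {j})" using Suc.hyps(2) j fin by simp
    show "finite (A - {j})" using fin by simp
    show "0 \<le> b n - m \<and> b n - m \<le> \<beta> - m" if "n \<in> A - {j}" for n
      using bnd m_le that by auto
    show "norm (\<Sum>n\<in>{n \<in> A - {j}. t \<le> b n - m}. z n) \<le> M" if "t > 0" for t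
    proof -
      have "{n \<in> A - {j}. t \<le> b n - m} = {n\<in>A. t + m \<le> b n}" using that j by auto
      then show ?thesis using lev[of "t + m"] that m0 by simp
    qed
  qed (use m0 Suc.prems in auto)
  have "(\<Sum>n\<in>A. smul (of_real (b n)) (z n))
      = (\<Sum>n\<in>A. smul (of_real m) (z n) + smul (of_real (b n - m)) (z n))"
    by (intro sum.cong) (simp_all add: scale_left_distrib[symmetric])
  also have "\<dots> = smul (of_real m) (\<Sum>n\<in>A. z n)
      + (\<Sum>n\<in>A. smul (of_real (b n - m)) (z n))"
    by (simp add: sum.distrib scale_sum_right)
  also have "(\<Sum>n\<in>A. smul (of_real (b n - m)) (z n))
      = (\<Sum>n\<in>A - {j}. smul (of_real (b n - m)) (z n))"
    using fin j by (intro sum.mono_neutral_right) auto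
  finally have "norm (\<Sum>n\<in>A. smul (of_real (b n)) (z n))
      \<le> m * norm (\<Sum>n\<in>A. z n) + (\<beta> - m) * M"
    using rest m0 norm_triangle_ineq[of "smul (of_real m) (\<Sum>n\<in>A. z n)"
        "\<Sum>n\<in>A - {j}. smul (of_real (b n - m)) (z n)"]
    by (simp add: norm_smul)
  then show ?case using whole by (simp add: algebra_simps)
qed

text \<open>The factor \<open>DIM('k)\<close> comes from treating the real coordinates of the multipliers separately,
  the factor 2 from their signs.\<close>

lemma norm_sum_multiplier_le:
  fixes d :: "nat \<Rightarrow> 'k"
  assumes "finite F"
    and sub: "\<And>G. G \<subseteq> F \<Longrightarrow> norm (\<Sum>n\<in>G. z n) \<le> M"
    and d: "\<And>n. n \<in> F \<Longrightarrow> norm (d n) \<le> 1"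
  shows "norm (\<Sum>n\<in>F. smul (d n) (z n)) \<le> 2 * real DIM('k) * M"
proof -
  have M: "0 \<le> M" using sub[of "{}"] by simp
  have pos: "norm (\<Sum>n\<in>F. smul (of_real (r n)) (z n)) \<le> M"
    if "\<And>n. n \<in> F \<Longrightarrow> 0 \<le> r n \<and> r n \<le> 1" for r
    using norm_sum_layer_cake[of F r 1 z M] assms(1) that sub M by auto
  have coord: "norm (\<Sum>n\<in>F. smul (of_real (r n)) (z n)) \<le> 2 * M"
    if r: "\<And>n. n \<in> F \<Longrightarrow> \<bar>r n\<bar> \<le> 1" for r
  proof -
    have "(\<Sum>n\<in>F. smul (of_real (r n)) (z n))
        = (\<Sum>n\<in>F. smul (of_real (max 0 (r n))) (z n))
          - (\<Sum>n\<in>F. smul (of_real (max 0 (- r n))) (z n))"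
      unfolding sum_subtractf[symmetric] scale_left_diff_distrib[symmetric] of_real_diff[symmetric]
      by (intro sum.cong arg_cong2[where f = smul] arg_cong[where f = of_real]) auto
    also have "norm \<dots> \<le> M + M"
      by (intro order_trans[OF norm_triangle_ineq4] add_mono pos) (use r in \<open>force+\<close>)
    finally show ?thesis by simp
  qed
  \<comment> \<open>A Euclidean basis vector \<open>i\<close> of the scalar field is itself a scalar
    of norm 1, so \<open>smul i\<close> is an isometry and each real coordinate can be bounded by
    \<open>coord\<close>.\<close>
  have "smul (d n) (z n) = (\<Sum>i\<in>Basis. smul i (smul (of_real (d n \<bullet> i)) (z n)))" for n
  proof -
    have "d n = (\<Sum>i\<in>Basis. i * of_real (d n \<bullet> i))"
      using euclidean_representation[of "d n"] by (simp add: scaleR_conv_of_real mult.commute)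
    then have "smul (d n) (z n) = smul (\<Sum>i\<in>Basis. i * of_real (d n \<bullet> i)) (z n)" by simp
    then show ?thesis by (simp add: scale_sum_left)
  qed
  then have "(\<Sum>n\<in>F. smul (d n) (z n))
      = (\<Sum>n\<in>F. \<Sum>i\<in>Basis. smul i (smul (of_real (d n \<bullet> i)) (z n)))" by simp
  also have "\<dots> = (\<Sum>i\<in>Basis. smul i (\<Sum>n\<in>F. smul (of_real (d n \<bullet> i)) (z n)))"
    by (subst sum.swap) (simp only: scale_sum_right)
  also have "norm \<dots> \<le> (\<Sum>i\<in>(Basis :: 'k set). 2 * M)"
  proof (rule sum_norm_le)
    fix i :: 'k assume i: "i \<in> Basis"
    have "\<bar>d n \<bullet> i\<bar> \<le> 1" if "n \<in> F" for n
      using Basis_le_norm[OF i, of "d n"] d[OF that] by linarith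
    then have "norm (\<Sum>n\<in>F. smul (of_real (d n \<bullet> i)) (z n)) \<le> 2 * M"
      by (rule coord)
    then show "norm (smul i (\<Sum>n\<in>F. smul (of_real (d n \<bullet> i)) (z n))) \<le> 2 * M"
      using i by (simp add: norm_smul)
  qed
  finally show ?thesis by simp
qed

end

section \<open>Coefficients and finite projections\<close>

locale banach_basis = banach_space_over smul
  for smul :: "'k::{real_normed_field, euclidean_space} \<Rightarrow> 'a::banach \<Rightarrow> 'a" +
  fixes e :: "nat \<Rightarrow> 'a"
  assumes basis: "basis smul e"
begin

abbreviation lincomb :: "nat set \<Rightarrow> (nat \<Rightarrow> 'k) \<Rightarrow> 'a" where
  "lincomb A a \<equiv> (\<Sum>n\<in>A. smul (a n) (e n))"

abbreviation co :: "'a \<Rightarrow> nat \<Rightarrow> 'k" where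
  "co x n \<equiv> coeff smul e n x"

abbreviation P :: "nat set \<Rightarrow> 'a \<Rightarrow> 'a" where
  "P A x \<equiv> greedy_sum smul e A x"

lemma ex1_coeff: "\<exists>!a. (\<lambda>n. smul (a n) (e n)) sums x"
  using basis by (simp add: basis_def schauder_basis_def)

lemma coeff_sums: "(\<lambda>n. smul (co x n) (e n)) sums x"
  unfolding coeff_def using theI'[OF ex1_coeff[of x]] by simp

lemma coeff_unique:
  assumes "(\<lambda>n. smul (a n) (e n)) sums x"
  shows "co x n = a n"
  unfolding coeff_def using the1_equality[OF ex1_coeff, OF assms] by simp

lemma coeff_add: "co (x + y) n = co x n + co y n"
  using sums_add[OF coeff_sums[of x] coeff_sums[of y]]
  by (intro coeff_unique[where a = "\<lambda>n. co x n + co y n"]) (simp add: scale_left_distrib)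

lemma coeff_diff: "co (x - y) n = co x n - co y n"
  using sums_diff[OF coeff_sums[of x] coeff_sums[of y]]
  by (intro coeff_unique[where a = "\<lambda>n. co x n - co y n"]) (simp add: scale_left_diff_distrib)

lemma coeff_lincomb:
  assumes "finite A"
  shows "co (lincomb A a) n = (if n \<in> A then a n else 0)"
proof (rule coeff_unique[where a = "\<lambda>n. if n \<in> A then a n else 0"])
  have "(\<lambda>n. if n \<in> A then smul (a n) (e n) else 0) sums lincomb A a"
    using assms by (rule sums_If_finite_set)
  then show "(\<lambda>n. smul (if n \<in> A then a n else 0) (e n)) sums lincomb A a"
    by (simp add: if_distrib[of "\<lambda>c. smul c _"] cong: if_cong)
qed

lemma norm_e_bounded_below: "\<exists>\<delta>>0. \<forall>n. \<delta> \<le> norm (e n)"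
proof -
  have "0 < (INF n. norm (e n))" using basis by (simp add: basis_def seminormalized_def)
  moreover have "(INF n. norm (e n)) \<le> norm (e n)" for n
    by (intro cINF_lower bdd_belowI[of _ 0]) auto
  ultimately show ?thesis by blast
qed

text \<open>The terms of the convergent expansion of \<open>x\<close> tend to 0, hence are bounded;
  the lower bound on the norms of the basis vectors passes this to the coefficients.\<close>

lemma coeff_bounded: "\<exists>T\<ge>0. \<forall>n. norm (co x n) \<le> T"
proof -
  obtain \<delta> where \<delta>: "\<delta> > 0" "\<And>n. \<delta> \<le> norm (e n)" using norm_e_bounded_below by blast
  have "(\<lambda>n. smul (co x n) (e n)) \<longlonglongrightarrow> 0"
    using coeff_sums[of x] by (intro summable_LIMSEQ_zero) (auto simp: summable_def)
  then have "Bseq (\<lambda>n. smul (co x n) (e n))"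
    by (intro convergent_imp_Bseq convergentI)
  then obtain K where K: "K > 0" "\<And>n. norm (smul (co x n) (e n)) \<le> K"
    unfolding Bseq_def by blast
  have "norm (co x n) \<le> K / \<delta>" for n
  proof -
    have "norm (co x n) * \<delta> \<le> norm (co x n) * norm (e n)"
      using \<delta> by (intro mult_left_mono) auto
    also have "\<dots> \<le> K" using K by (simp add: norm_smul)
    finally show ?thesis using \<delta> by (simp add: le_divide_eq)
  qed
  then show ?thesis using K \<delta> by (intro exI[of _ "K / \<delta>"]) auto
qed

lemma lincomb_one_nonzero:
  assumes "finite A" "A \<noteq> {}"
  shows "lincomb A (\<lambda>_. 1) \<noteq> 0"
proof
  assume "lincomb A (\<lambda>_. 1) = 0"
  then have "co 0 n = (if n \<in> A then 1 else 0)" for n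
    using coeff_lincomb[OF assms(1), where a = "\<lambda>_. 1"] by simp
  moreover have "co 0 n = 0" for n using coeff_lincomb[where A = "{}"] by simp
  ultimately show False using assms(2) by (metis all_not_in_conv zero_neq_one)
qed

lemma proj_eq: "finite A \<Longrightarrow> proj smul e A x = P A x"
  by (simp add: proj_finite greedy_sum_def)

lemma P_add: "P A (x + y) = P A x + P A y"
  by (simp add: greedy_sum_def coeff_add scale_left_distrib sum.distrib)

lemma P_diff: "P A (x - y) = P A x - P A y"
  by (simp add: greedy_sum_def coeff_diff scale_left_diff_distrib sum_subtractf)

lemma P_lincomb:
  assumes "finite A" "finite B"
  shows "P B (lincomb A a) = lincomb (A \<inter> B) a"
proof -
  have "P B (lincomb A a) = (\<Sum>n\<in>B. if n \<in> A then smul (a n) (e n) else 0)"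
    unfolding greedy_sum_def by (intro sum.cong) (auto simp: coeff_lincomb assms)
  also have "\<dots> = lincomb (A \<inter> B) a"
    by (simp add: sum.If_cases assms Int_commute)
  finally show ?thesis .
qed

lemma P_Un:
  assumes "finite A" "finite B" "A \<inter> B = {}"
  shows "P (A \<union> B) x = P A x + P B x"
  unfolding greedy_sum_def using assms by (rule sum.union_disjoint)

text \<open>Unlike in the definition of \<open>quasi_greedy\<close>, the empty set is allowed here.\<close>

definition quasi_greedy_with :: "real \<Rightarrow> bool" where
  "quasi_greedy_with C \<longleftrightarrow> C \<ge> 1 \<and>
     (\<forall>x L. greedy_set smul e x (card L) L \<longrightarrow> norm (x - P L x) \<le> C * norm x)"

lemma quasi_greedyE:
  assumes "quasi_greedy smul e"
  obtains C where "quasi_greedy_with C"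
proof -
  obtain C where C: "C \<ge> 1" "\<And>x m L. m \<ge> 1 \<Longrightarrow> greedy_set smul e x m L \<Longrightarrow>
      norm (x - P L x) \<le> C * norm x"
    using assms unfolding quasi_greedy_def by blast
  have "norm (x - P L x) \<le> C * norm x" if "greedy_set smul e x (card L) L" for x L
  proof (cases "L = {}")
    case True
    then show ?thesis using C(1) mult_right_mono[of 1 C "norm x"] by (simp add: greedy_sum_def)
  next
    case False
    then have "card L \<ge> 1"
      using that by (simp add: greedy_set_def Suc_le_eq card_gt_0_iff)
    then show ?thesis using C(2) that by blast
  qed
  then show ?thesis using that C(1) unfolding quasi_greedy_with_def by blast
qed

lemma quasi_greedy_withD:
  assumes "quasi_greedy_with C" "finite L"
    and "\<And>n k. n \<in> L \<Longrightarrow> k \<notin> L \<Longrightarrow> norm (co x k) \<le> norm (co x n)"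
  shows "norm (x - P L x) \<le> C * norm x"
  using assms unfolding quasi_greedy_with_def greedy_set_def by blast

section \<open>Coefficient domination for quasi-greedy bases\<close>

lemma lincomb_remove_greedy:
  assumes "quasi_greedy_with C" "finite F" "G \<subseteq> F"
    and "\<And>n k. n \<in> G \<Longrightarrow> k \<in> F - G \<Longrightarrow> norm (c k) \<le> norm (c n)"
  shows "norm (lincomb (F - G) c) \<le> C * norm (lincomb F c)"
proof -
  have G: "finite G" using assms finite_subset by blast
  have "lincomb F c - P G (lincomb F c) = lincomb (F - G) c"
    using assms(2,3) G by (simp add: P_lincomb sum_diff Int_absorb1)
  moreover have "norm (lincomb F c - P G (lincomb F c)) \<le> C * norm (lincomb F c)"
    using assms G by (intro quasi_greedy_withD) (auto simp: coeff_lincomb)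
  ultimately show ?thesis by simp
qed

text \<open>The multipliers \<open>s / norm (c n)\<close> lie in [0,1] and decrease in the modulus
  of \<open>c n\<close>. A superlevel set thus keeps the smallest coefficients, and its complement
  in \<open>F\<close> is greedy.\<close>

lemma lincomb_flatten:
  assumes "quasi_greedy_with C" "finite F" "s \<ge> 0"
    and "\<And>n. n \<in> F \<Longrightarrow> s \<le> norm (c n)"
  shows "norm (lincomb F (\<lambda>n. of_real (s / norm (c n)) * c n)) \<le> C * norm (lincomb F c)"
proof -
  have C: "C \<ge> 1" using assms(1) by (simp add: quasi_greedy_with_def)
  have lev: "norm (\<Sum>n\<in>{n\<in>F. t \<le> s / norm (c n)}. smul (c n) (e n)) \<le> C * norm (lincomb F c)"
    if t: "t > 0" for t
  proof -
    define G where "G = {n\<in>F. s / norm (c n) < t}"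
    have "{n\<in>F. t \<le> s / norm (c n)} = F - G" by (auto simp: G_def)
    moreover have "norm (c k) \<le> norm (c n)" if "n \<in> G" "k \<in> F - G" for n k
    proof (rule ccontr)
      assume less: "\<not> norm (c k) \<le> norm (c n)"
      have tk: "t \<le> s / norm (c k)" and tn: "s / norm (c n) < t"
        using that by (auto simp: G_def)
      \<comment> \<open>This excludes \<open>c n = 0\<close>, where the quotient would be 0 by
        convention and would not be monotone.\<close>
      have "s > 0" using t tk assms(3) by (cases "s = 0") auto
      then have "norm (c n) > 0" using assms(4)[of n] that by (auto simp: G_def)
      then have "s / norm (c k) \<le> s / norm (c n)"
        using less assms(3) by (intro divide_left_mono mult_pos_pos) auto
      then show False using tk tn by linarith
    qed
    ultimately show ?thesis
      using lincomb_remove_greedy[OF assms(1,2), of G c] by (auto simp: G_def)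
  qed
  have "norm (\<Sum>n\<in>F. smul (of_real (s / norm (c n))) (smul (c n) (e n)))
      \<le> 1 * (C * norm (lincomb F c))"
  proof (rule norm_sum_layer_cake)
    show "0 \<le> s / norm (c n) \<and> s / norm (c n) \<le> 1" if "n \<in> F" for n
      using assms(3) assms(4)[OF that] by (auto simp: divide_le_eq_1)
  qed (use assms lev C in auto)
  then show ?thesis by (simp add: scale_scale)
qed

text \<open>One factor \<open>C\<close> flattens \<open>c\<close> to \<open>u\<close> of constant
  modulus \<open>s\<close>. Another bounds all partial sums of \<open>u\<close>, since ties make
  every subset of \<open>F\<close> greedy. The multipliers \<open>b n / u n\<close> cost the
  remaining factor.\<close>

lemma lincomb_dominated:
  assumes "quasi_greedy_with C" "finite F"
    and "\<And>n. n \<in> F \<Longrightarrow> norm (b n) \<le> s" "\<And>n. n \<in> F \<Longrightarrow> s \<le> norm (c n)" "s \<ge> 0"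
  shows "norm (lincomb F b) \<le> 2 * real DIM('k) * C\<^sup>2 * norm (lincomb F c)"
proof -
  define u where "u n = of_real (s / norm (c n)) * c n" for n
  have C: "C \<ge> 1" using assms(1) by (simp add: quasi_greedy_with_def)
  have u: "norm (u n) = s" if "n \<in> F" for n
    using assms(4)[OF that] assms(5) by (cases "c n = 0") (auto simp: u_def norm_mult norm_divide)
  have sub: "norm (lincomb G u) \<le> C * norm (lincomb F u)" if "G \<subseteq> F" for G
  proof -
    have "F - (F - G) = G" using that by auto
    moreover have "norm (lincomb (F - (F - G)) u) \<le> C * norm (lincomb F u)"
      using u by (intro lincomb_remove_greedy[OF assms(1,2)]) auto
    ultimately show ?thesis by simp
  qed
  \<comment> \<open>If \<open>u n = 0\<close> then \<open>s = 0\<close>, which forces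
    \<open>b n = 0\<close> as well.\<close>
  have b: "b n = b n / u n * u n" if "n \<in> F" for n
    using assms(3)[OF that] u[OF that] by (cases "u n = 0") auto
  have "lincomb F b = (\<Sum>n\<in>F. smul (b n / u n) (smul (u n) (e n)))"
    by (intro sum.cong) (use b in \<open>auto simp: scale_scale\<close>)
  also have "norm \<dots> \<le> 2 * real DIM('k) * (C * norm (lincomb F u))"
  proof (rule norm_sum_multiplier_le)
    show "norm (b n / u n) \<le> 1" if "n \<in> F" for n
      using assms(3)[OF that] u[OF that] assms(5)
      by (cases "s = 0") (auto simp: norm_divide divide_le_eq_1)
  qed (use assms sub in auto)
  also have "\<dots> \<le> 2 * real DIM('k) * (C * (C * norm (lincomb F c)))"
    using lincomb_flatten[OF assms(1,2,5,4)] C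
    by (intro mult_left_mono) (auto simp: u_def)
  finally show ?thesis by (simp add: power2_eq_square mult.assoc)
qed

section \<open>The norm weight and the almost greedy property\<close>

text \<open>A sum over an infinite set is 0 by default, so a positive value has to be set there; 1
  is an arbitrary choice, as only finite sets are compared below.\<close>

definition norm_weight :: "nat set \<Rightarrow> ennreal" where
  "norm_weight A = (if finite A then ennreal (norm (lincomb A (\<lambda>_. 1))) else 1)"

lemma weight_norm_weight: "weight norm_weight"
  using lincomb_one_nonzero by (auto simp: weight_def norm_weight_def)

text \<open>With \<open>s\<close> the least modulus of \<open>c\<close> on \<open>F\<close>, the
  chain runs from \<open>b\<close> to the constant \<open>s\<close> on \<open>D\<close>, by the
  weights to the constant \<open>s\<close> on \<open>F\<close>, and then to \<open>c\<close>. Each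
  of the two dominations costs \<open>K\<close>.\<close>

lemma lincomb_le_of_norm_weight:
  assumes "quasi_greedy_with C" "finite D" "finite F" "norm_weight D \<le> norm_weight F"
    and le: "\<And>k n. k \<in> D \<Longrightarrow> n \<in> F \<Longrightarrow> norm (b k) \<le> norm (c n)"
  shows "norm (lincomb D b) \<le> (2 * real DIM('k) * C\<^sup>2)\<^sup>2 * norm (lincomb F c)"
proof (cases "F = {}")
  case True
  \<comment> \<open>The minimum defining \<open>s\<close> needs \<open>F\<close> nonempty; for empty
    \<open>F\<close> positivity of the weight forces \<open>D\<close> to be empty.\<close>
  have "D = {}"
  proof (rule ccontr)
    assume "D \<noteq> {}"
    then have "0 < norm_weight D" using weight_norm_weight by (simp add: weight_def)
    then show False using assms(4) True weight_norm_weight by (simp add: weight_def)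
  qed
  then show ?thesis by simp
next
  case False
  define K where "K = 2 * real DIM('k) * C\<^sup>2"
  define s where "s = Min (norm ` c ` F)"
  have K: "K \<ge> 0" by (simp add: K_def)
  have "s \<in> norm ` c ` F" unfolding s_def using assms False by (intro Min_in) auto
  then have s: "s \<ge> 0" "\<And>k. k \<in> D \<Longrightarrow> norm (b k) \<le> s" using le by auto
  have s_le: "s \<le> norm (c n)" if "n \<in> F" for n
    unfolding s_def using assms that by (intro Min_le) auto
  have scaled: "norm (lincomb A (\<lambda>_. of_real s)) = s * norm (lincomb A (\<lambda>_. 1))" for A
  proof -
    have "lincomb A (\<lambda>_. of_real s) = smul (of_real s) (lincomb A (\<lambda>_. 1))"
      by (simp add: scale_sum_right)
    then show ?thesis using s by (simp add: norm_smul)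
  qed
  have "norm (lincomb D b) \<le> K * norm (lincomb D (\<lambda>_. of_real s))"
    unfolding K_def using s assms by (intro lincomb_dominated) auto
  also have "\<dots> \<le> K * norm (lincomb F (\<lambda>_. of_real s))"
    unfolding scaled using K s assms(2-4)
    by (intro mult_left_mono) (auto simp: norm_weight_def)
  also have "\<dots> \<le> K * (K * norm (lincomb F c))"
    using K unfolding K_def
    by (intro mult_left_mono lincomb_dominated[where s = s]) (use assms s s_le in auto)
  finally show ?thesis by (simp add: K_def power2_eq_square mult.assoc)
qed

lemma quasi_greedy_imp_weight_almost_greedy:
  assumes "quasi_greedy smul e"
  shows "weight_almost_greedy smul e norm_weight"
proof -
  obtain C where C: "quasi_greedy_with C" using assms by (rule quasi_greedyE)
  then have C1: "C \<ge> 1" by (simp add: quasi_greedy_with_def)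
  define Q where "Q = (2 * real DIM('k) * C\<^sup>2)\<^sup>2"
  \<comment> \<open>\<open>C\<close> bounds \<open>y - P (L - A) y\<close>, hence
    \<open>1 + C\<close> bounds \<open>P (L - A) y\<close>; \<open>Q\<close> is the price of
    exchanging \<open>L - A\<close> for \<open>A - L\<close>.\<close>
  define R where "R = C + Q * (1 + C)"
  have Q: "Q \<ge> 0" by (simp add: Q_def)
  then have R: "R \<ge> 1" using C1 by (simp add: R_def add_increasing2)
  have bound: "norm (x - P L x) \<le> R * norm (x - P A x)"
    if L: "greedy_set smul e x m L" and A: "finite A" "norm_weight (A - L) \<le> norm_weight (L - A)"
    for x m L A
  proof -
    define y where "y = x - P A x"
    have finL: "finite L" and grL: "\<And>n k. n \<in> L \<Longrightarrow> k \<notin> L \<Longrightarrow> norm (co x k) \<le> norm (co x n)"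
      using L by (auto simp: greedy_set_def)
    have co_y: "co y n = (if n \<in> A then 0 else co x n)" for n
      using A by (simp add: y_def coeff_diff greedy_sum_def coeff_lincomb)
    \<comment> \<open>The coefficients of \<open>y\<close> vanish on \<open>A\<close> and agree with
      those of \<open>x\<close> elsewhere, so \<open>L - A\<close> is greedy for
      \<open>y\<close>.\<close>
    have rest: "norm (y - P (L - A) y) \<le> C * norm y"
      using C finL grL by (intro quasi_greedy_withD) (auto simp: co_y)
    have Py: "P (L - A) y = lincomb (L - A) (co x)"
      unfolding greedy_sum_def by (intro sum.cong) (auto simp: co_y)
    have "norm (P (A - L) x) \<le> Q * norm (P (L - A) y)"
      unfolding Py Q_def using C A finL grL
      by (subst greedy_sum_def) (intro lincomb_le_of_norm_weight, auto)
    also have "\<dots> \<le> Q * (norm y + norm (y - P (L - A) y))"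
      using Q norm_triangle_ineq4[of y "y - P (L - A) y"] by (intro mult_left_mono) auto
    also have "\<dots> \<le> Q * ((1 + C) * norm y)"
      using Q rest by (intro mult_left_mono) (auto simp: algebra_simps)
    finally have swap: "norm (P (A - L) x) \<le> Q * ((1 + C) * norm y)" .
    \<comment> \<open>Both sides are the projection of \<open>x\<close> onto
      \<open>A \<union> L\<close>.\<close>
    have "P A x + P (L - A) x = P L x + P (A - L) x"
      using P_Un[of A "L - A" x] P_Un[of L "A - L" x] A finL
      by (simp add: Un_commute)
    moreover have "P (L - A) y = P (L - A) x" unfolding Py by (simp add: greedy_sum_def)
    ultimately have "x - P L x = (y - P (L - A) y) + P (A - L) x"
      by (simp add: y_def algebra_simps)
    then have "norm (x - P L x) \<le> C * norm y + Q * ((1 + C) * norm y)"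
      using norm_triangle_ineq[of "y - P (L - A) y" "P (A - L) x"] rest swap by simp
    then show ?thesis by (simp add: R_def y_def algebra_simps)
  qed
  have "norm (x - P L x) \<le> R * sigma_tilde smul e norm_weight L x"
    if "greedy_set smul e x m L" for x m L
    unfolding sigma_tilde_def
  proof (rule le_mult_cInf)
    show "{norm (x - proj smul e A x) |A. finite A \<and> norm_weight (A - L) \<le> norm_weight (L - A)}
        \<noteq> {}" using that by (auto simp: greedy_set_def intro!: exI[of _ L])
  qed (use R bound that in \<open>auto simp: proj_eq\<close>)
  then show ?thesis unfolding weight_almost_greedy_def using R by blast
qed

text \<open>Since \<open>w {} = 0\<close>, the empty set is always admissible, so
  \<open>sigma_tilde\<close> is at most \<open>norm x\<close>.\<close>

lemma weight_almost_greedy_imp_quasi_greedy: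
  assumes "weight w" "weight_almost_greedy smul e w"
  shows "quasi_greedy smul e"
proof -
  obtain C where C: "C \<ge> 1" "\<And>x m L. m \<ge> 1 \<Longrightarrow> greedy_set smul e x m L \<Longrightarrow>
      norm (x - P L x) \<le> C * sigma_tilde smul e w L x"
    using assms(2) unfolding weight_almost_greedy_def by blast
  have "sigma_tilde smul e w L x \<le> norm x" for L x
    unfolding sigma_tilde_def
  proof (rule cInf_lower)
    show "norm x \<in> {norm (x - proj smul e A x) |A. finite A \<and> w (A - L) \<le> w (L - A)}"
      using assms(1) by (auto simp: proj_finite weight_def intro!: exI[of _ "{}"])
  qed (auto intro!: bdd_belowI[of _ 0])
  then have "C * sigma_tilde smul e w L x \<le> C * norm x" for L x
    using C(1) by (intro mult_left_mono) auto
  then show ?thesis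
    unfolding quasi_greedy_def using C order_trans by blast
qed

section \<open>Unconditionality and the greedy property\<close>

lemma unconditional_imp_finite_bound:
  assumes "unconditional smul e"
  obtains C :: real where "C \<ge> 1" "\<And>A x. finite A \<Longrightarrow> norm (P A x) \<le> C * norm x"
proof -
  obtain C where "C \<ge> 1" "\<And>x A. norm (proj smul e A x) \<le> C * norm x"
    using assms unfolding unconditional_def by blast
  then show ?thesis using that[of C] by (metis proj_eq)
qed

text \<open>A block of the series for \<open>proj smul e A x\<close> is a finite projection of the
  same block of the expansion of \<open>x\<close>. The Cauchy criterion therefore carries over, and
  the norm bound passes to the limit.\<close>

lemma finite_bound_imp_unconditional:
  assumes "C \<ge> 1" and bound: "\<And>A x. finite A \<Longrightarrow> norm (P A x) \<le> C * norm x"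
  shows "unconditional smul e"
proof -
  have "summable (proj_term smul e A x) \<and> norm (proj smul e A x) \<le> C * norm x" for x A
  proof
    have partial: "sum (proj_term smul e A x) I = P (A \<inter> I) x" if "finite I" for I
      unfolding proj_term_def greedy_sum_def using that by (simp add: sum.If_cases Int_commute)
    have cauchy: "\<exists>N. \<forall>m\<ge>N. \<forall>n. norm (lincomb {m..<n} (co x)) < \<epsilon>" if "\<epsilon> > 0" for \<epsilon>
      using that coeff_sums[of x] sums_summable summable_Cauchy by blast
    show summ: "summable (proj_term smul e A x)"
      unfolding summable_Cauchy
    proof (intro allI impI)
      fix \<epsilon> :: real assume \<epsilon>: "\<epsilon> > 0"
      then have "\<epsilon> / C > 0" using assms(1) by simp
      then obtain N where N: "\<And>m n. m \<ge> N \<Longrightarrow> norm (lincomb {m..<n} (co x)) < \<epsilon> / C"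
        using cauchy by blast
      have "norm (sum (proj_term smul e A x) {m..<n}) < \<epsilon>" if "m \<ge> N" for m n
      proof -
        have "P (A \<inter> {m..<n}) (lincomb {m..<n} (co x)) = P (A \<inter> {m..<n}) x"
          by (subst P_lincomb) (auto simp: greedy_sum_def intro!: sum.cong)
        then have "norm (sum (proj_term smul e A x) {m..<n}) \<le> C * norm (lincomb {m..<n} (co x))"
          using bound[of "A \<inter> {m..<n}" "lincomb {m..<n} (co x)"] by (simp add: partial)
        also have "\<dots> < \<epsilon>" using N[OF that] assms(1) by (simp add: less_divide_eq mult.commute)
        finally show ?thesis .
      qed
      then show "\<exists>N. \<forall>m\<ge>N. \<forall>n. norm (sum (proj_term smul e A x) {m..<n}) < \<epsilon>" by blast
    qed
    have "(\<lambda>n. \<Sum>k<n. proj_term smul e A x k) \<longlonglongrightarrow> proj smul e A x"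
      unfolding proj_def using summ by (rule summable_LIMSEQ)
    then have "(\<lambda>n. norm (\<Sum>k<n. proj_term smul e A x k)) \<longlonglongrightarrow> norm (proj smul e A x)"
      by (rule tendsto_norm)
    then show "norm (proj smul e A x) \<le> C * norm x"
      by (rule LIMSEQ_le_const2) (auto simp: partial bound)
  qed
  then show ?thesis unfolding unconditional_def using assms(1) by blast
qed

lemma finite_bound_imp_quasi_greedy_with:
  assumes "C \<ge> 1" and bound: "\<And>A x. finite A \<Longrightarrow> norm (P A x) \<le> C * norm x"
  shows "quasi_greedy_with (1 + C)"
proof -
  have "norm (x - P L x) \<le> (1 + C) * norm x" if "finite L" for x L
    using norm_triangle_ineq4[of x "P L x"] bound[OF that, of x] by (simp add: algebra_simps)
  then show ?thesis using assms(1) by (auto simp: quasi_greedy_with_def greedy_set_def)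
qed

lemma unconditional_imp_weight_greedy:
  assumes "unconditional smul e"
  shows "weight_greedy smul e norm_weight"
proof -
  obtain C where C1: "C \<ge> 1" and C: "\<And>A x. finite A \<Longrightarrow> norm (P A x) \<le> C * norm x"
    using unconditional_imp_finite_bound[OF assms] by blast
  define Q where "Q = (2 * real DIM('k) * (1 + C)\<^sup>2)\<^sup>2"
  define R where "R = 1 + C + Q * C"
  have Q: "Q \<ge> 0" by (simp add: Q_def)
  then have R: "R \<ge> 1" using C1 by (simp add: R_def add_increasing2)
  have bound: "norm (x - P L x) \<le> R * norm (x - lincomb A a)"
    if L: "greedy_set smul e x m L" and A: "finite A" "norm_weight (A - L) \<le> norm_weight (L - A)"
    for x m L A a
  proof -
    define y where "y = x - lincomb A a"
    have finL: "finite L" and grL: "\<And>n k. n \<in> L \<Longrightarrow> k \<notin> L \<Longrightarrow> norm (co x k) \<le> norm (co x n)"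
      using L by (auto simp: greedy_set_def)
    have Py: "P (L - A) y = lincomb (L - A) (co x)"
      unfolding greedy_sum_def
      by (intro sum.cong) (auto simp: y_def coeff_diff coeff_lincomb A)
    have "norm (P (A - L) x) \<le> Q * norm (P (L - A) y)"
      unfolding Py Q_def using finite_bound_imp_quasi_greedy_with[OF C1 C] A finL grL
      by (subst greedy_sum_def) (intro lincomb_le_of_norm_weight, auto)
    \<comment> \<open>Here \<open>y\<close> may have nonzero coefficients on \<open>A\<close>, so
      \<open>L - A\<close> need not be greedy for it; the uniform bound on finite projections takes
      over.\<close>
    also have "\<dots> \<le> Q * (C * norm y)"
      using Q C finL by (intro mult_left_mono) auto
    finally have swap: "norm (P (A - L) x) \<le> Q * (C * norm y)" .
    have "P (L \<union> A) x = P L x + P (A - L) x"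
      using P_Un[of L "A - L" x] A finL by simp
    \<comment> \<open>The approximant is supported in \<open>A\<close>, so \<open>x\<close> and
      \<open>y\<close> leave the same remainder after projection onto
      \<open>L \<union> A\<close>.\<close>
    moreover have "P (L \<union> A) (lincomb A a) = lincomb A a"
      using A finL by (simp add: P_lincomb Int_absorb2)
    ultimately have "x - P L x = y - P (L \<union> A) y + P (A - L) x"
      by (simp add: y_def P_diff)
    then have "norm (x - P L x) \<le> norm y + C * norm y + Q * (C * norm y)"
      using norm_triangle_ineq[of "y - P (L \<union> A) y" "P (A - L) x"]
        norm_triangle_ineq4[of y "P (L \<union> A) y"] C[of "L \<union> A" y] A finL swap by simp
    then show ?thesis by (simp add: R_def y_def algebra_simps)
  qed
  have "norm (x - P L x) \<le> R * sigma smul e norm_weight L x"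
    if "greedy_set smul e x m L" for x m L
    unfolding sigma_def
  proof (rule le_mult_cInf)
    show "{norm (x - lincomb A a) |A a. finite A \<and> norm_weight (A - L) \<le> norm_weight (L - A)}
        \<noteq> {}" using that by (auto simp: greedy_set_def intro!: exI[of _ L])
  qed (use R bound that in auto)
  then show ?thesis unfolding weight_greedy_def using R by blast
qed

lemma weight_greedy_imp_unconditional:
  assumes "weight_greedy smul e w"
  shows "unconditional smul e"
proof -
  obtain C where C1: "C \<ge> 1" and C: "\<And>x m L. m \<ge> 1 \<Longrightarrow> greedy_set smul e x m L \<Longrightarrow>
      norm (x - P L x) \<le> C * sigma smul e w L x"
    using assms unfolding weight_greedy_def by blast
  have "norm (P B x) \<le> (1 + C) * norm x" if B: "finite B" for B x
  proof (cases "B = {}")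
    case True
    then show ?thesis using C1 by (simp add: greedy_sum_def)
  next
    case False
    obtain T where T: "T \<ge> 0" "\<And>n. norm (co x n) \<le> T" using coeff_bounded by blast
    \<comment> \<open>With amplitude \<open>2 * T\<close> the coefficients of \<open>x + z\<close>
      on \<open>B\<close> have modulus at least \<open>2 * T - T = T\<close>, which no coefficient
      outside \<open>B\<close> exceeds.\<close>
    define z where "z = lincomb B (\<lambda>_. of_real (2 * T))"
    have co_y: "co (x + z) n = (if n \<in> B then co x n + of_real (2 * T) else co x n)" for n
      by (simp add: z_def coeff_add coeff_lincomb B)
    have "T \<le> norm (co (x + z) n)" if "n \<in> B" for n
      using norm_diff_ineq[of "of_real (2 * T) :: 'k" "co x n"] T(1) T(2)[of n] that
      unfolding co_y norm_of_real by (simp add: add.commute)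
    then have "greedy_set smul e (x + z) (card B) B"
      using B T(2) unfolding greedy_set_def by (auto simp: co_y intro: order_trans)
    moreover have "card B \<ge> 1" using B False by (simp add: Suc_le_eq card_gt_0_iff)
    ultimately have "norm (x + z - P B (x + z)) \<le> C * sigma smul e w B (x + z)"
      using C by blast
    also have "\<dots> \<le> C * norm x"
    proof (rule mult_left_mono)
      \<comment> \<open>Witness for the infimum: the support \<open>A = B\<close> makes both set
        differences empty, and \<open>z\<close> is the approximant.\<close>
      have "norm x = norm (x + z - lincomb B (\<lambda>_. of_real (2 * T)))" by (simp add: z_def)
      then show "sigma smul e w B (x + z) \<le> norm x"
        unfolding sigma_def
        by (intro cInf_lower bdd_belowI[of _ 0] CollectI exI conjI) (use B in auto)
    qed (use C1 in simp)
    also have "x + z - P B (x + z) = x - P B x"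
      using B by (simp add: P_add z_def P_lincomb)
    finally have "norm (x - P B x) \<le> C * norm x" .
    then show ?thesis
      using norm_triangle_ineq4[of x "x - P B x"] by (simp add: algebra_simps)
  qed
  then show ?thesis using C1 by (intro finite_bound_imp_unconditional[of "1 + C"]) auto
qed

end

theorem corollary2p11:
  fixes smul :: "'k::{real_normed_field, euclidean_space} \<Rightarrow> 'a::banach \<Rightarrow> 'a"
    and e :: "nat \<Rightarrow> 'a"
  assumes "banach_space_over smul"
    and "basis smul e"
  shows "(unconditional smul e \<longleftrightarrow> (\<exists>w. weight w \<and> weight_greedy smul e w)) \<and>
         (quasi_greedy smul e \<longleftrightarrow> (\<exists>w. weight w \<and> weight_almost_greedy smul e w))"
proof -
  interpret banach_basis smul e
    using assms by (intro banach_basis.intro banach_basis_axioms.intro)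
  show ?thesis
    using weight_norm_weight unconditional_imp_weight_greedy weight_greedy_imp_unconditional
      quasi_greedy_imp_weight_almost_greedy weight_almost_greedy_imp_quasi_greedy by blast
qed

end
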